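(* Let $p\ge 1$, let $M$ be a positive measure on $(0,+\infty)$, and let $\mathbf{\Sigma}:\mathbf{x}\mapsto\mathbf{\Sigma}_{\mathbf{x}}$ be a mapping from $\mathbb{R}^p$ to the set of real symmetric positive definite $p\times p$ matrices. For $t>0$ and $\mathbf{x}\in\mathbb{R}^p$ let $k_{\mathbf{x}}(\cdot;t)$ be the $p$-variate Gaussian density centered at $\mathbf{x}$ with covariance matrix $\frac{t^2}{4}\mathbf{\Sigma}_{\mathbf{x}}$. Let $g(\cdot;t):\mathbb{R}^p\to\mathbb{R}$, $t>0$, be a family of functions such that $g(\mathbf{x};\cdot)\in L^2(M)$ for every $\mathbf{x}\in\mathbb{R}^p$. Put $f_{\mathbf{x}}(\mathbf{u};t)=g(\mathbf{x};t)k_{\mathbf{x}}(\mathbf{u};t)$ and assume $\int_0^{+\infty}\int_{\mathbb{R}^p}f_{\mathbf{x}}(\mathbf{u};t)^2\,d\mathbf{u}\,M(dt)<+\infty$ for every $\mathbf{x}\in\mathbb{R}^p$. Then the covariance function $$C^{NS}(\mathbf{x},\mathbf{y})=\int_0^{+\infty}\left(\int_{\mathbb{R}^p}f_{\mathbf{x}}(\mathbf{u};t)f_{\mathbf{y}}(\mathbf{u};t)\,d\mathbf{u}\right)M(dt)$$ is given, for all $\mathbf{x},\mathbf{y}\in\mathbb{R}^p$, by $$C^{NS}(\mathbf{x},\mathbf{y})=\pi^{-\frac p2}\left|\frac{\mathbf{\Sigma}_{\mathbf{x}}+\mathbf{\Sigma}_{\mathbf{y}}}{2}\right|^{-\fr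ac12}\int_0^{+\infty}g(\mathbf{x};t)g(\mathbf{y};t)\,t^{-p}\exp\left(-\frac{Q_{\mathbf{x}\mathbf{y}}(\mathbf{x}-\mathbf{y})}{t^2}\right)M(dt).$$
   Context: Here $|A|$ denotes the determinant of a matrix $A$, and for $\mathbf{h}\in\mathbb{R}^p$, $Q_{\mathbf{x}\mathbf{y}}(\mathbf{h})=\mathbf{h}^T\left(\frac{\mathbf{\Sigma}_{\mathbf{x}}+\mathbf{\Sigma}_{\mathbf{y}}}{2}\right)^{-1}\mathbf{h}$. *)

theory Defs
  imports "HOL-Analysis.Analysis"
begin

definition sym_pos_def :: "real ^ 'p ^ 'p \<Rightarrow> bool" where
  "sym_pos_def A \<longleftrightarrow> transpose A = A \<and> (\<forall>v. v \<noteq> 0 \<longrightarrow> v \<bullet> (A *v v) > 0)"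

definition gaussian_density :: "real ^ 'p \<Rightarrow> real ^ 'p ^ 'p \<Rightarrow> real ^ 'p \<Rightarrow> real" where
  "gaussian_density m S u =
     (2 * pi) powr (- real CARD('p) / 2) * det S powr (- 1 / 2)
       * exp (- ((u - m) \<bullet> (matrix_inv S *v (u - m))) / 2)"

(* Square-integrable functions, not classes modulo null sets. *)
definition L2 :: "'a measure \<Rightarrow> ('a \<Rightarrow> real) set" where
  "L2 M = {h. h \<in> borel_measurable M \<and> integrable M (\<lambda>t. (h t)\<^sup>2)}"

definition kern :: "(real ^ 'p \<Rightarrow> real ^ 'p ^ 'p) \<Rightarrow> real ^ 'p \<Rightarrow> real ^ 'p \<Rightarrow> real \<Rightarrow> real" where
  "kern \<Sigma> x u t = gaussian_density x ((t\<^sup>2 / 4) *\<^sub>R \<Sigma> x) u"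

definition f_ns :: "(real ^ 'p \<Rightarrow> real ^ 'p ^ 'p) \<Rightarrow> (real ^ 'p \<Rightarrow> real \<Rightarrow> real)
    \<Rightarrow> real ^ 'p \<Rightarrow> real ^ 'p \<Rightarrow> real \<Rightarrow> real" where
  "f_ns \<Sigma> g x u t = g x t * kern \<Sigma> x u t"

(* Bochner integrals are 0 for non-integrable integrands, so the formula is meaningful only
   together with integrability of the integrands. *)
definition C_NS :: "real measure \<Rightarrow> (real ^ 'p \<Rightarrow> real ^ 'p ^ 'p) \<Rightarrow> (real ^ 'p \<Rightarrow> real \<Rightarrow> real)
    \<Rightarrow> real ^ 'p \<Rightarrow> real ^ 'p \<Rightarrow> real" where
  "C_NS M \<Sigma> g x y = (LINT t|M. (LINT u|lborel. f_ns \<Sigma> g x u t * f_ns \<Sigma> g y u t))"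

definition avg_cov :: "(real ^ 'p \<Rightarrow> real ^ 'p ^ 'p) \<Rightarrow> real ^ 'p \<Rightarrow> real ^ 'p \<Rightarrow> real ^ 'p ^ 'p" where
  "avg_cov \<Sigma> x y = (1 / 2) *\<^sub>R (\<Sigma> x + \<Sigma> y)"

definition Q_form :: "(real ^ 'p \<Rightarrow> real ^ 'p ^ 'p) \<Rightarrow> real ^ 'p \<Rightarrow> real ^ 'p \<Rightarrow> real ^ 'p \<Rightarrow> real" where
  "Q_form \<Sigma> x y h = h \<bullet> (matrix_inv (avg_cov \<Sigma> x y) *v h)"

end

theory Submission
  imports Defs "HOL-Probability.Distributions"
begin

text \<open>The inner integral is evaluated in closed form for every \<open>t > 0\<close>: the product of the Gaussian
  densities with means \<open>x\<close>, \<open>y\<close> and covariances \<open>S\<close>, \<open>T\<close> is, after completing the square, a Gaussian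
  density in \<open>u\<close> times the centred Gaussian density with covariance \<open>S + T\<close> at \<open>x - y\<close>. For
  \<open>S + T\<close> equal to \<open>t\<^sup>2 / 2\<close> times the average of the two matrices \<open>\<Sigma>\<close>, the latter is the kernel of the
  formula. On the diagonal \<open>x = y\<close> the square-integrability assumption then says that
  \<open>g(x; t)\<^sup>2 t\<^sup>-\<^sup>p\<close> is \<open>M\<close>-integrable, and \<open>2 \<bar>g(x; t) g(y; t)\<bar> \<le> g(x; t)\<^sup>2 + g(y; t)\<^sup>2\<close> gives the
  integrability off the diagonal.\<close>

section \<open>Linear changes of variables\<close>

text \<open>By Fubini with the coordinate along \<open>b\<close> innermost: \<open>\<phi>\<close> is
  constant on each line in direction \<open>b\<close>, so on such a line the shear is a translation,
  which preserves Lebesgue measure.\<close>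

lemma nn_integral_lborel_shear:
  fixes h :: "'a::euclidean_space \<Rightarrow> ennreal"
  assumes [measurable]: "h \<in> borel_measurable borel" "\<phi> \<in> borel_measurable borel"
    and b: "b \<in> Basis" and \<phi>: "\<And>v s. \<phi> (v + s *\<^sub>R b) = \<phi> v"
  shows "(\<integral>\<^sup>+v. h (v + \<phi> v *\<^sub>R b) \<partial>lborel) = (\<integral>\<^sup>+v. h v \<partial>lborel)"
proof -
  let ?B = "Basis - {b} :: 'a set"
  let ?F = "\<lambda>x::'a \<Rightarrow> real. \<Sum>c\<in>Basis. x c *\<^sub>R c"
  let ?G = "\<lambda>x::'a \<Rightarrow> real. \<Sum>c\<in>?B. x c *\<^sub>R c"
  interpret product_sigma_finite "\<lambda>_::'a. lborel :: real measure" ..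
  have ins: "insert b ?B = Basis"
    using b by auto
  have F: "?F (x(b := y)) = ?G x + y *\<^sub>R b" for x y
    using b by (simp add: sum.remove[of Basis b] add.commute)
  \<comment> \<open>Lebesgue measure is the image of a product measure over \<open>Basis\<close>;
    the factor of \<open>b\<close> is split off and integrated first.\<close>
  have split: "(\<integral>\<^sup>+v. k v \<partial>lborel) = (\<integral>\<^sup>+x. (\<integral>\<^sup>+y. k (?G x + y *\<^sub>R b) \<partial>lborel) \<partial>Pi\<^sub>M ?B (\<lambda>_. lborel))"
    if [measurable]: "k \<in> borel_measurable borel" for k :: "'a \<Rightarrow> ennreal"
  proof -
    have "(\<integral>\<^sup>+v. k v \<partial>lborel) = (\<integral>\<^sup>+x. k (?F x) \<partial>Pi\<^sub>M Basis (\<lambda>_. lborel))"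
      by (subst lborel_eq, subst nn_integral_distr) auto
    also have "\<dots> = (\<integral>\<^sup>+x. (\<integral>\<^sup>+y. k (?F (x(b := y))) \<partial>lborel) \<partial>Pi\<^sub>M ?B (\<lambda>_. lborel))"
      using product_nn_integral_insert[of ?B b "\<lambda>x. k (?F x)"] unfolding ins by simp
    finally show ?thesis
      unfolding F .
  qed
  have "(\<integral>\<^sup>+y. h (?G x + y *\<^sub>R b + \<phi> (?G x + y *\<^sub>R b) *\<^sub>R b) \<partial>lborel) = (\<integral>\<^sup>+y. h (?G x + y *\<^sub>R b) \<partial>lborel)" for x
    using nn_integral_real_affine[of "\<lambda>y. h (?G x + y *\<^sub>R b)" 1 "\<phi> (?G x)"]
    by (simp add: \<phi> scaleR_add_left add.assoc add.left_commute add.commute[of "\<phi> _ *\<^sub>R b"])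
  then show ?thesis
    by (simp add: split)
qed

lemma Basis_cart: "Basis = range (\<lambda>i. axis i 1 :: real ^ 'n)"
  by (auto simp: Basis_vec_def)

lemma prod_Basis_cart: "(\<Prod>b\<in>Basis. f (b :: real ^ 'n)) = (\<Prod>i\<in>UNIV. f (axis i 1))"
  unfolding Basis_cart by (subst prod.reindex) (auto simp: inj_on_def axis_eq_axis)

lemma prod_inner_Basis_cart: "(\<Prod>b\<in>Basis. w \<bullet> b) = (\<Prod>i\<in>UNIV. (w :: real ^ 'n) $ i)"
  by (simp add: prod_Basis_cart inner_axis)

text \<open>Lebesgue measure is determined by its values on boxes. Swapping two coordinates is an
  involution, so the preimage of a box is the box with swapped corners; its side lengths are
  permuted and their product is unchanged.\<close>

lemma nn_integral_lborel_transpose: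
  fixes h :: "real ^ 'n \<Rightarrow> ennreal"
  assumes [measurable]: "h \<in> borel_measurable borel"
  shows "(\<integral>\<^sup>+v. h (\<chi> i. v $ Transposition.transpose m n i) \<partial>lborel) = (\<integral>\<^sup>+v. h v \<partial>lborel)"
proof -
  let ?T = "\<lambda>v::real^'n. \<chi> i. v $ Transposition.transpose m n i"
  have "linear ?T"
    by (rule linearI) (simp_all add: vec_eq_iff)
  then have [measurable]: "?T \<in> borel_measurable borel"
    by (intro borel_measurable_continuous_onI linear_continuous_on linear_conv_bounded_linear[THEN iffD1])
  have "lborel = distr lborel borel ?T"
  proof (rule lborel_eqI)
    fix l u :: "real^'n"
    assume le: "\<And>b. b \<in> Basis \<Longrightarrow> l \<bullet> b \<le> u \<bullet> b"
    then have le': "l $ i \<le> u $ i" for i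
      using le[of "axis i 1"] by (simp add: inner_axis)
    have le'': "?T l \<bullet> b \<le> ?T u \<bullet> b" if "b \<in> Basis" for b
      using that le' by (auto simp: Basis_vec_def inner_axis)
    have "?T -` box l u = box (?T l) (?T u)"
      by (auto simp: mem_box_cart) (metis transpose_involutory)+
    then have "emeasure (distr lborel borel ?T) (box l u) = (\<Prod>b\<in>Basis. (?T u - ?T l) \<bullet> b)"
      using le'' by (subst emeasure_distr) auto
    also have "\<dots> = (\<Prod>i\<in>UNIV. (u - l) $ Transposition.transpose m n i)"
      unfolding prod_inner_Basis_cart by simp
    also have "\<dots> = (\<Prod>i\<in>UNIV. (u - l) $ i)"
      using prod.permute[OF permutes_swap_id, where S=UNIV and g="\<lambda>i. (u - l) $ i", of m n]
      by (simp add: o_def)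
    also have "\<dots> = (\<Prod>b\<in>Basis. (u - l) \<bullet> b)"
      unfolding prod_inner_Basis_cart ..
    finally show "emeasure (distr lborel borel ?T) (box l u) = (\<Prod>b\<in>Basis. (u - l) \<bullet> b)" .
  qed simp
  then have "(\<integral>\<^sup>+v. h v \<partial>lborel) = (\<integral>\<^sup>+v. h v \<partial>distr lborel borel ?T)"
    by simp
  also have "\<dots> = (\<integral>\<^sup>+v. h (?T v) \<partial>lborel)"
    by (rule nn_integral_distr) auto
  finally show ?thesis ..
qed

lemma borel_measurable_matrix_vector_mult [measurable]:
  "(\<lambda>v. (A :: real ^ 'n ^ 'm) *v v) \<in> borel_measurable borel"
  by (intro borel_measurable_continuous_onI matrix_vector_mult_linear_continuous_on)

text \<open>A diagonal matrix scales each coordinate separately, so this is the coordinatewise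
  affine substitution with zero translation.\<close>

lemma nn_integral_lborel_matrix_diagonal:
  fixes A :: "real ^ 'n ^ 'n" and h :: "real ^ 'n \<Rightarrow> ennreal"
  assumes [measurable]: "h \<in> borel_measurable borel"
    and A: "\<And>i j. i \<noteq> j \<Longrightarrow> A $ i $ j = 0" and det: "det A \<noteq> 0"
  shows "(\<integral>\<^sup>+v. h v \<partial>lborel) = \<bar>det A\<bar> * (\<integral>\<^sup>+v. h (A *v v) \<partial>lborel)"
proof -
  have detA: "det A = (\<Prod>i\<in>UNIV. A $ i $ i)"
    using A by (rule det_diagonal)
  \<comment> \<open>The diagonal entries, indexed by basis vectors instead of by \<open>'n\<close>,
    as \<open>lborel_affine_euclidean\<close> expects its scaling factors.\<close>
  define c where "c = (\<lambda>j::real^'n. (A *v j) \<bullet> j)"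
  have Ai: "A *v axis i 1 = A $ i $ i *\<^sub>R axis i 1" for i
    using A unfolding matrix_vector_mult_basis by (auto simp: vec_eq_iff column_def axis_def)
  have ca: "c (axis i 1) = A $ i $ i" for i
    by (simp add: c_def Ai inner_axis_axis)
  have c0: "c j \<noteq> 0" if "j \<in> Basis" for j
    using that det unfolding detA Basis_cart by (auto simp: ca)
  have prodc: "(\<Prod>j\<in>Basis. \<bar>c j\<bar>) = \<bar>det A\<bar>"
    unfolding prod_Basis_cart detA by (simp add: ca abs_prod)
  have Av: "(\<Sum>j\<in>Basis. (c j * (v \<bullet> j)) *\<^sub>R j) = A *v v" for v
  proof -
    have "A *v v = A *v (\<Sum>j\<in>Basis. (v \<bullet> j) *\<^sub>R j)"
      by (simp add: euclidean_representation)
    also have "\<dots> = (\<Sum>j\<in>Basis. (v \<bullet> j) *\<^sub>R (A *v j))"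
      by (simp add: linear_sum[OF matrix_vector_mul_linear] matrix_vector_mult_scaleR)
    also have "\<dots> = (\<Sum>j\<in>Basis. (c j * (v \<bullet> j)) *\<^sub>R j)"
      by (rule sum.cong) (auto simp: Basis_cart Ai ca)
    finally show ?thesis ..
  qed
  have "lborel = density (distr lborel borel (\<lambda>v. A *v v)) (\<lambda>_. ennreal \<bar>det A\<bar>)"
    using lborel_affine_euclidean[of c 0] c0 by (simp add: Av prodc)
  then have "(\<integral>\<^sup>+v. h v \<partial>lborel) = (\<integral>\<^sup>+v. h v \<partial>density (distr lborel borel (\<lambda>v. A *v v)) (\<lambda>_. ennreal \<bar>det A\<bar>))"
    by simp
  also have "\<dots> = \<bar>det A\<bar> * (\<integral>\<^sup>+v. h (A *v v) \<partial>lborel)"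
    by (simp add: nn_integral_density nn_integral_distr nn_integral_cmult)
  finally show ?thesis .
qed

text \<open>The change of variables theorem of the library requires a well-ordered index type, which an
  arbitrary finite type is not; elementary matrices give the linear case without an order.\<close>

lemma nn_integral_lborel_matrix:
  fixes A :: "real ^ 'n ^ 'n" and h :: "real ^ 'n \<Rightarrow> ennreal"
  assumes "det A \<noteq> 0" "h \<in> borel_measurable borel"
  shows "(\<integral>\<^sup>+v. h v \<partial>lborel) = \<bar>det A\<bar> * (\<integral>\<^sup>+v. h (A *v v) \<partial>lborel)"
  using assms
proof (induction A arbitrary: h rule: induct_matrix_elementary)
  case (1 A B)
  note [measurable] = \<open>h \<in> borel_measurable borel\<close>
  have det: "det A \<noteq> 0" "det B \<noteq> 0"
    using \<open>det (A ** B) \<noteq> 0\<close> by (auto simp: det_mul)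
  \<comment> \<open>The induction hypothesis for \<open>A\<close> is applied to \<open>h\<close>,
    the one for \<open>B\<close> to \<open>h\<close> composed with \<open>A\<close>; this is why
    \<open>h\<close> is generalized in the induction.\<close>
  have "(\<integral>\<^sup>+v. h v \<partial>lborel) = \<bar>det A\<bar> * (\<integral>\<^sup>+v. h (A *v v) \<partial>lborel)"
    by (rule 1(1)[OF det(1)]) measurable
  also have "(\<integral>\<^sup>+v. h (A *v v) \<partial>lborel) = \<bar>det B\<bar> * (\<integral>\<^sup>+v. h (A *v (B *v v)) \<partial>lborel)"
    by (rule 1(2)[OF det(2)]) measurable
  finally show ?case
    by (simp add: det_mul abs_mult ennreal_mult mult.assoc matrix_vector_mul_assoc)
next
  \<comment> \<open>A zero row contradicts the nonzero determinant.\<close>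
  case (2 A i)
  then show ?case
    using det_zero_row(2)[of i A] by (simp add: row_def vec_eq_iff)
next
  case (3 A)
  then show ?case
    by (intro nn_integral_lborel_matrix_diagonal) auto
next
  case (4 m n)
  let ?A = "\<chi> i j. mat 1 $ i $ Transposition.transpose m n j :: real ^ 'n ^ 'n"
  have "(\<Sum>j\<in>UNIV. (if i = Transposition.transpose m n j then 1 else 0) * v $ j)
      = (\<Sum>j\<in>UNIV. if j = Transposition.transpose m n i then v $ j else 0)" for i and v :: "real ^ 'n"
    by (rule sum.cong) auto
  then have "?A *v v = (\<chi> i. v $ Transposition.transpose m n i)" for v
    by (simp add: vec_eq_iff matrix_vector_mult_def mat_def)
  moreover have "\<bar>det ?A\<bar> = 1"
    using 4(1) by (simp add: det_permute_columns permutes_swap_id sign_swap_id)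
  ultimately show ?case
    using nn_integral_lborel_transpose[OF 4(3)] by simp
next
  \<comment> \<open>This matrix adds \<open>c\<close> times coordinate \<open>n\<close> to
    coordinate \<open>m\<close>, which is a shear of determinant 1.\<close>
  case (5 m n c)
  let ?A = "\<chi> i j. if i = m \<and> j = n then c else of_bool (i = j) :: real ^ 'n ^ 'n"
  have Av: "?A *v v = v + (c * v $ n) *\<^sub>R axis m 1" for v
  proof -
    have "(\<Sum>j\<in>UNIV. (if i = m \<and> j = n then c else of_bool (i = j)) * v $ j)
        = (\<Sum>j\<in>UNIV. (if j = n then (if i = m then c * v $ j else 0) else 0) + (if j = i then v $ j else 0))" for i
      using 5(1) by (intro sum.cong) auto
    then show ?thesis
      by (auto simp: vec_eq_iff matrix_vector_mult_def axis_def sum.distrib)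
  qed
  have "?A = (\<chi> k. if k = m then row m (mat 1) + c *s row n (mat 1) else row k (mat 1))"
    using 5(1) by (auto simp: vec_eq_iff row_def mat_def)
  then have "det ?A = 1"
    using det_row_operation[OF 5(1), of "mat 1" c] by simp
  \<comment> \<open>Moving along axis \<open>m\<close> leaves coordinate \<open>n\<close> alone, so
    the amount of the shear is constant in the direction of the shear.\<close>
  moreover have "axis m (1::real) $ n = 0"
    using 5(1) by (simp add: axis_def)
  then have "(\<integral>\<^sup>+v. h (v + (c * v $ n) *\<^sub>R axis m 1) \<partial>lborel) = (\<integral>\<^sup>+v. h v \<partial>lborel)"
    using 5 by (intro nn_integral_lborel_shear) auto
  ultimately show ?case
    unfolding Av by simp
qed

section \<open>Symmetric positive definite matrices\<close>

lemma matrix_inv_works: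
  fixes A :: "real ^ 'n ^ 'n"
  assumes "invertible A"
  shows "A ** matrix_inv A = mat 1" "matrix_inv A ** A = mat 1"
  using someI_ex[of "\<lambda>A'. A ** A' = mat 1 \<and> A' ** A = mat 1"] assms
  unfolding invertible_def matrix_inv_def by auto

lemma matrix_inv_eqI:
  fixes A B :: "real ^ 'n ^ 'n"
  assumes "A ** B = mat 1"
  shows "matrix_inv A = B"
proof -
  have "B ** A = mat 1"
    using assms by (simp add: matrix_left_right_inverse)
  then have "invertible A"
    using assms by (auto simp: invertible_def)
  then have "matrix_inv A ** (A ** B) = B"
    by (simp add: matrix_mul_assoc matrix_inv_works)
  then show ?thesis
    by (simp add: assms)
qed

lemma matrix_add_rdistrib: "((A :: real ^ 'n ^ 'm) + B) ** C = A ** C + B ** C"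
  by (simp add: vec_eq_iff matrix_matrix_mult_def distrib_right sum.distrib)

lemma det_scaleR: "det (c *\<^sub>R (A :: real ^ 'n ^ 'n)) = c ^ CARD('n) * det A"
proof -
  have "c *\<^sub>R A = mat c ** A"
    by (simp add: vec_eq_iff matrix_matrix_mult_def mat_def if_distrib[of "\<lambda>x. x * _"] cong: if_cong)
  then show ?thesis
    by (simp add: det_mul det_diagonal mat_def)
qed

lemma matrix_inv_scaleR:
  fixes A :: "real ^ 'n ^ 'n"
  assumes "c \<noteq> 0" "invertible A"
  shows "matrix_inv (c *\<^sub>R A) = (1 / c) *\<^sub>R matrix_inv A"
  by (rule matrix_inv_eqI) (simp add: assms matrix_scalar_ac scalar_matrix_assoc[symmetric] matrix_inv_works)

lemma sym_pos_def_symmetric: "sym_pos_def A \<Longrightarrow> u \<bullet> (A *v v) = v \<bullet> (A *v u)"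
  by (metis dot_lmul_matrix inner_commute sym_pos_def_def transpose_matrix_vector)

lemma sym_pos_def_nonneg: "sym_pos_def A \<Longrightarrow> 0 \<le> v \<bullet> (A *v v)"
  by (cases "v = 0") (auto simp: sym_pos_def_def less_imp_le)

lemma sym_pos_def_add: "sym_pos_def A \<Longrightarrow> sym_pos_def B \<Longrightarrow> sym_pos_def (A + B)"
  by (auto simp: sym_pos_def_def transpose_def vec_eq_iff matrix_vector_mult_add_rdistrib inner_add_right add_pos_pos)

lemma sym_pos_def_scaleR: "sym_pos_def A \<Longrightarrow> 0 < c \<Longrightarrow> sym_pos_def (c *\<^sub>R A)"
  by (auto simp: sym_pos_def_def transpose_scalar scaleR_matrix_vector_assoc[symmetric])

text \<open>Gram-Schmidt for the inner product \<open>u \<bullet> (A *v v)\<close>, run over an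
  arbitrary finite set. Applied to \<open>Basis\<close> it yields a basis that is orthonormal with
  respect to \<open>A\<close>.\<close>

lemma sym_pos_def_orthonormal_span:
  fixes A :: "real ^ 'n ^ 'n"
  assumes A: "sym_pos_def A" and "finite F"
  shows "\<exists>B. finite B \<and> (\<forall>x\<in>B. \<forall>y\<in>B. x \<bullet> (A *v y) = of_bool (x = y)) \<and> span B = span F"
  using \<open>finite F\<close>
proof (induction F)
  case empty
  show ?case by (intro exI[of _ "{}"]) auto
next
  case (insert a F)
  then obtain B where B: "finite B" "span B = span F"
    and orth: "\<And>x y. x \<in> B \<Longrightarrow> y \<in> B \<Longrightarrow> x \<bullet> (A *v y) = of_bool (x = y)"
    by blast
  \<comment> \<open>The projection of \<open>a\<close> onto \<open>span B\<close>, orthogonal with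
    respect to \<open>A\<close>; the remainder \<open>w\<close> is what \<open>a\<close> adds to the
    span.\<close>
  define p where "p = (\<Sum>s\<in>B. (s \<bullet> (A *v a)) *\<^sub>R s)"
  define w where "w = a - p"
  have p: "p \<in> span B"
    unfolding p_def by (intro span_sum span_scale span_base)
  have span_a: "span (insert a F) = span (insert w B)"
  proof -
    have "span (insert a F) = span (insert a B)"
      by (simp add: span_insert B(2))
    also have "\<dots> = span (insert w B)"
      using eq_span_insert_eq[of a w B] p by (simp add: w_def)
    finally show ?thesis .
  qed
  have orthw: "y \<bullet> (A *v w) = 0" if "y \<in> B" for y
  proof -
    have "y \<bullet> (A *v p) = (\<Sum>s\<in>B. (s \<bullet> (A *v a)) * (y \<bullet> (A *v s)))"
      unfolding p_def
      by (simp add: linear_sum[OF matrix_vector_mul_linear] matrix_vector_mult_scaleR inner_sum_right)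
    also have "\<dots> = (\<Sum>s\<in>B. if y = s then s \<bullet> (A *v a) else 0)"
      by (intro sum.cong) (auto simp: orth that)
    finally show ?thesis
      using B(1) that by (simp add: w_def matrix_vector_mult_diff_distrib inner_diff_right)
  qed
  show ?case
  \<comment> \<open>If the remainder vanishes, \<open>a\<close> already lies in the span and
    \<open>B\<close> is kept; otherwise the normalized remainder joins \<open>B\<close>.\<close>
  proof (cases "w = 0")
    case True
    then have "span (insert a F) = span B"
      by (simp add: span_a)
    then show ?thesis
      using B orth by (intro exI[of _ B]) auto
  next
    case False
    define r where "r = sqrt (w \<bullet> (A *v w))"
    define e where "e = (1 / r) *\<^sub>R w"
    have "0 < w \<bullet> (A *v w)"
      using A False by (simp add: sym_pos_def_def)
    then have r: "0 < r" "r * r = w \<bullet> (A *v w)"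
      by (auto simp: r_def)
    have ee: "e \<bullet> (A *v e) = 1"
      using r(1) by (simp add: e_def matrix_vector_mult_scaleR r(2)[symmetric])
    have ye: "y \<bullet> (A *v e) = 0" "e \<bullet> (A *v y) = 0" if "y \<in> B" for y
      using orthw[OF that] sym_pos_def_symmetric[OF A, of e y]
      by (simp_all add: e_def matrix_vector_mult_scaleR)
    have "e \<notin> B"
      using ye(1) ee by fastforce
    have "span (insert e B) = span (insert w B)"
    proof -
      have "e \<in> span (insert w B)"
        unfolding e_def by (intro span_scale span_base) simp
      moreover have "w = r *\<^sub>R e"
        using r(1) by (simp add: e_def)
      then have "w \<in> span (insert e B)"
        by (metis insertI1 span_base span_scale)
      ultimately show ?thesis
        by (intro span_eq[THEN iffD2] conjI) (auto intro: span_base)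
    qed
    then show ?thesis
      using B(1) orth ye ee \<open>e \<notin> B\<close> span_a by (intro exI[of _ "insert e B"]) auto
  qed
qed

text \<open>The columns of \<open>P\<close> form an \<open>A\<close>-orthonormal basis: entry
  \<open>(i, j)\<close> of the product is the \<open>A\<close>-inner product of columns
  \<open>i\<close> and \<open>j\<close>. Substituting \<open>P\<close> turns the quadratic form of
  \<open>A\<close> into \<open>v \<bullet> v\<close>.\<close>

lemma sym_pos_def_congruent_mat_1:
  fixes A :: "real ^ 'n ^ 'n"
  assumes A: "sym_pos_def A"
  obtains P :: "real ^ 'n ^ 'n" where "transpose P ** A ** P = mat 1"
proof -
  obtain B where fin: "finite B" and span: "span B = (UNIV :: (real ^ 'n) set)"
    and orth: "\<And>x y. x \<in> B \<Longrightarrow> y \<in> B \<Longrightarrow> x \<bullet> (A *v y) = of_bool (x = y)"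
    using sym_pos_def_orthonormal_span[OF A, of Basis] by auto
  \<comment> \<open>Independence fixes the number of vectors as \<open>CARD('n)\<close>, so that
    they can be indexed by \<open>'n\<close> as columns. Pairing a vanishing combination with
    \<open>v\<close> isolates the coefficient of \<open>v\<close>.\<close>
  have "independent B"
    unfolding dependent_finite[OF fin]
  proof clarify
    fix f v assume v: "v \<in> B" "f v \<noteq> 0" and 0: "(\<Sum>s\<in>B. f s *\<^sub>R s) = 0"
    have "0 = v \<bullet> (A *v (\<Sum>s\<in>B. f s *\<^sub>R s))"
      by (simp add: 0)
    also have "\<dots> = (\<Sum>s\<in>B. f s * (v \<bullet> (A *v s)))"
      by (simp add: linear_sum[OF matrix_vector_mul_linear] matrix_vector_mult_scaleR inner_sum_right)
    also have "\<dots> = (\<Sum>s\<in>B. if v = s then f s else 0)"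
      by (intro sum.cong) (auto simp: orth v)
    finally show False
      using fin v by simp
  qed
  then have "card B = CARD('n)"
    using span by (metis dim_UNIV dim_span_eq_card_independent DIM_cart DIM_real mult.right_neutral)
  then obtain b where b: "bij_betw b (UNIV :: 'n set) B"
    using fin finite_same_card_bij[of "UNIV :: 'n set" B] by auto
  define P :: "real ^ 'n ^ 'n" where "P = (\<chi> i j. b j $ i)"
  have col: "column j P = b j" for j
    by (simp add: P_def column_def vec_eq_iff)
  have "(transpose P ** A ** P) $ i $ j = of_bool (i = j)" for i j
  proof -
    have "(transpose P ** A ** P) $ i $ j = axis i 1 \<bullet> ((transpose P ** A ** P) *v axis j 1)"
      by (simp add: matrix_vector_mult_basis column_def inner_axis')
    also have "\<dots> = (P *v axis i 1) \<bullet> (A *v (P *v axis j 1))"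
      by (metis dot_lmul_matrix inner_commute matrix_vector_mul_assoc transpose_matrix_vector)
    also have "\<dots> = of_bool (b i = b j)"
      using b by (simp add: matrix_vector_mult_basis col orth bij_betwE)
    finally show ?thesis
      using b by (simp add: bij_betw_def inj_eq)
  qed
  then have "transpose P ** A ** P = mat 1"
    by (simp add: vec_eq_iff mat_def of_bool_def)
  then show ?thesis ..
qed

lemma det_congruent_mat_1:
  fixes A P :: "real ^ 'n ^ 'n"
  assumes "transpose P ** A ** P = mat 1"
  shows "(det P)\<^sup>2 * det A = 1"
  using arg_cong[OF assms, of det] by (simp add: det_mul power2_eq_square mult_ac)

lemma sym_pos_def_det_pos:
  fixes A :: "real ^ 'n ^ 'n"
  assumes A: "sym_pos_def A"
  shows "0 < det A"
proof -
  obtain P :: "real ^ 'n ^ 'n" where "transpose P ** A ** P = mat 1"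
    using sym_pos_def_congruent_mat_1[OF A] .
  then have "(det P)\<^sup>2 * det A = 1"
    by (rule det_congruent_mat_1)
  then show ?thesis
    by (metis zero_le_power2 zero_less_mult_iff zero_less_one not_less)
qed

lemma sym_pos_def_invertible: "sym_pos_def A \<Longrightarrow> invertible A"
  using sym_pos_def_det_pos[of A] by (simp add: invertible_det_nz)

text \<open>The transposed inverse is a right inverse of the symmetric \<open>A\<close>, hence
  equals the inverse. With \<open>v = A *v w\<close>, the form of the inverse at \<open>v\<close> is
  the form of \<open>A\<close> at \<open>w\<close>.\<close>

lemma sym_pos_def_matrix_inv:
  assumes A: "sym_pos_def A"
  shows "sym_pos_def (matrix_inv A)"
proof -
  note inv = matrix_inv_works[OF sym_pos_def_invertible[OF A]]
  have "A ** transpose (matrix_inv A) = mat 1"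
    using A inv by (metis matrix_transpose_mul sym_pos_def_def transpose_mat)
  then have "transpose (matrix_inv A) = matrix_inv A"
    by (metis matrix_inv_eqI)
  moreover have "0 < v \<bullet> (matrix_inv A *v v)" if "v \<noteq> 0" for v
  proof -
    define w where "w = matrix_inv A *v v"
    have v: "v = A *v w"
      by (simp add: w_def matrix_vector_mul_assoc inv)
    with that have "w \<noteq> 0"
      by auto
    then have "0 < w \<bullet> (A *v w)"
      using A by (simp add: sym_pos_def_def)
    then show ?thesis
      by (simp add: v[symmetric] w_def[symmetric] inner_commute)
  qed
  ultimately show ?thesis
    by (simp add: sym_pos_def_def)
qed

section \<open>Products of Gaussian densities\<close>

lemma nn_integral_exp_neg_half_square:
  "(\<integral>\<^sup>+x. ennreal (exp (- x\<^sup>2 / 2)) \<partial>lborel) = ennreal (sqrt (2 * pi))"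
proof -
  have "(\<integral>\<^sup>+x. ennreal (exp (- x\<^sup>2 / 2)) \<partial>lborel)
      = (\<integral>\<^sup>+x. ennreal (sqrt (2 * pi)) * ennreal (std_normal_density x) \<partial>lborel)"
    by (intro nn_integral_cong) (simp add: std_normal_density_def ennreal_mult[symmetric])
  also have "\<dots> = ennreal (sqrt (2 * pi)) * (\<integral>\<^sup>+x. ennreal (std_normal_density x) \<partial>lborel)"
    by (rule nn_integral_cmult) simp
  also have "(\<integral>\<^sup>+x. ennreal (std_normal_density x) \<partial>lborel) = 1"
    by (subst nn_integral_eq_integral) auto
  finally show ?thesis
    by simp
qed

text \<open>The exponential of a sum over coordinates is a product, so the integral factors into
  one-dimensional Gaussian integrals.\<close>

lemma nn_integral_exp_neg_half_inner:
  "(\<integral>\<^sup>+v. ennreal (exp (- (v \<bullet> v) / 2)) \<partial>(lborel :: 'a::euclidean_space measure))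
    = ennreal ((2 * pi) powr (DIM('a) / 2))"
proof -
  have "exp (- (v \<bullet> v) / 2) = (\<Prod>b\<in>Basis. exp (- (v \<bullet> b)\<^sup>2 / 2))" for v :: 'a
    by (simp add: euclidean_inner[of v v] exp_sum[symmetric] sum_negf sum_divide_distrib power2_eq_square)
  then have "(\<integral>\<^sup>+v. ennreal (exp (- (v \<bullet> v) / 2)) \<partial>(lborel :: 'a measure))
      = (\<integral>\<^sup>+v. (\<Prod>b\<in>Basis. ennreal (exp (- (v \<bullet> b)\<^sup>2 / 2))) \<partial>(lborel :: 'a measure))"
    by (simp add: prod_ennreal)
  also have "\<dots> = (\<Prod>b\<in>(Basis :: 'a set). ennreal (sqrt (2 * pi)))"
    by (subst nn_integral_lborel_prod) (auto simp: nn_integral_exp_neg_half_square[simplified])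
  also have "\<dots> = ennreal ((2 * pi) powr (DIM('a) / 2))"
    by (simp add: ennreal_power powr_half_sqrt[symmetric] powr_powr powr_realpow[symmetric])
  finally show ?thesis .
qed

text \<open>Substituting \<open>P *v v\<close>, with \<open>P\<close> congruently reducing
  \<open>A\<close> to the identity, leaves the standard Gaussian integral; the Jacobian is
  \<open>\<bar>det P\<bar> = det A powr (- 1 / 2)\<close>.\<close>

lemma nn_integral_exp_neg_half_quadratic_form:
  fixes A :: "real ^ 'n ^ 'n"
  assumes A: "sym_pos_def A"
  shows "(\<integral>\<^sup>+v. ennreal (exp (- (v \<bullet> (A *v v)) / 2)) \<partial>lborel)
    = ennreal ((2 * pi) powr (CARD('n) / 2) * det A powr (- 1 / 2))"
proof -
  obtain P :: "real ^ 'n ^ 'n" where P: "transpose P ** A ** P = mat 1"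
    using sym_pos_def_congruent_mat_1[OF A] .
  have det: "(det P)\<^sup>2 * det A = 1"
    using P by (rule det_congruent_mat_1)
  then have "det P \<noteq> 0"
    by auto
  have "\<bar>det P\<bar> = sqrt (1 / det A)"
    using det sym_pos_def_det_pos[OF A] by (metis eq_divide_eq less_irrefl real_sqrt_abs)
  also have "\<dots> = det A powr (- 1 / 2)"
    using sym_pos_def_det_pos[OF A]
    by (simp add: powr_minus_divide powr_half_sqrt real_sqrt_divide)
  finally have detP: "\<bar>det P\<bar> = det A powr (- 1 / 2)" .
  have PAP: "(P *v v) \<bullet> (A *v (P *v v)) = v \<bullet> v" for v
    by (metis P dot_lmul_matrix inner_commute matrix_vector_mul_assoc matrix_vector_mul_lid transpose_matrix_vector)
  have "(\<integral>\<^sup>+v. ennreal (exp (- (v \<bullet> (A *v v)) / 2)) \<partial>lborel)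
      = \<bar>det P\<bar> * (\<integral>\<^sup>+v. ennreal (exp (- ((P *v v) \<bullet> (A *v (P *v v))) / 2)) \<partial>lborel)"
    using \<open>det P \<noteq> 0\<close> by (rule nn_integral_lborel_matrix) measurable
  then show ?thesis
    unfolding PAP nn_integral_exp_neg_half_inner
    by (simp add: detP ennreal_mult[symmetric] mult.commute)
qed

text \<open>Translation removes \<open>m\<close>, and the quadratic form integral for the inverse of
  \<open>S\<close> gives a constant that cancels the normalization. Computing a nonnegative integral
  yields integrability together with the value.\<close>

lemma has_bochner_integral_gaussian_density:
  fixes S :: "real ^ 'n ^ 'n"
  assumes S: "sym_pos_def S"
  shows "has_bochner_integral lborel (gaussian_density m S) 1"
proof (rule has_bochner_integral_nn_integral)
  note S' = sym_pos_def_matrix_inv[OF S]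
  let ?K = "(2 * pi) powr (- real CARD('n) / 2) * det S powr (- 1 / 2)"
  let ?h = "\<lambda>v. ennreal (exp (- (v \<bullet> (matrix_inv S *v v)) / 2))"
  have "S ** matrix_inv S = mat 1"
    by (intro matrix_inv_works sym_pos_def_invertible S)
  then have "det S * det (matrix_inv S) = 1"
    by (metis det_I det_mul)
  then have det: "det S powr (- 1 / 2) * det (matrix_inv S) powr (- 1 / 2) = 1"
    using sym_pos_def_det_pos[OF S] sym_pos_def_det_pos[OF S']
    by (simp flip: powr_mult)
  have "(\<integral>\<^sup>+u. ennreal (gaussian_density m S u) \<partial>lborel) = (\<integral>\<^sup>+u. ennreal ?K * ?h (- m + u) \<partial>lborel)"
    by (intro nn_integral_cong) (simp add: gaussian_density_def ennreal_mult[symmetric])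
  also have "\<dots> = ennreal ?K * (\<integral>\<^sup>+u. ?h (- m + u) \<partial>lborel)"
    by (rule nn_integral_cmult) measurable
  also have "(\<integral>\<^sup>+u. ?h (- m + u) \<partial>lborel) = (\<integral>\<^sup>+u. ?h u \<partial>distr lborel borel ((+) (- m)))"
    by (subst nn_integral_distr) auto
  also have "\<dots> = ennreal ((2 * pi) powr (CARD('n) / 2) * det (matrix_inv S) powr (- 1 / 2))"
    unfolding lborel_distr_plus by (rule nn_integral_exp_neg_half_quadratic_form[OF S'])
  also have "ennreal ?K * \<dots> = ennreal (((2 * pi) powr (- real CARD('n) / 2) * (2 * pi) powr (CARD('n) / 2))
      * (det S powr (- 1 / 2) * det (matrix_inv S) powr (- 1 / 2)))"
    by (simp add: ennreal_mult[symmetric] mult_ac)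
  also have "\<dots> = ennreal 1"
    unfolding det by (simp flip: powr_add)
  finally show "(\<integral>\<^sup>+u. ennreal (gaussian_density m S u) \<partial>lborel) = ennreal 1" .
qed (auto simp: gaussian_density_def[abs_def])

text \<open>The substitution \<open>p = S (S + T)\<^sup>-\<^sup>1 (x - y)\<close>, \<open>q = - T (S + T)\<^sup>-\<^sup>1 (x - y)\<close> satisfies
  \<open>x - p = y - q\<close>; this common value is the mean of the product density, and completing the
  square around it needs no matrix inverse other than that of \<open>S + T\<close>.\<close>

lemma gaussian_density_mult:
  fixes S T :: "real ^ 'n ^ 'n"
  assumes S: "sym_pos_def S" and T: "sym_pos_def T"
  obtains m where "\<And>u. gaussian_density x S u * gaussian_density y T u
    = gaussian_density 0 (S + T) (x - y)
      * gaussian_density m (matrix_inv (matrix_inv S + matrix_inv T)) u"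
proof -
  define A B C U where "A = matrix_inv S" and "B = matrix_inv T" and "C = A + B" and "U = matrix_inv (S + T)"
  have spd: "sym_pos_def A" "sym_pos_def B" "sym_pos_def C" "sym_pos_def (S + T)"
    unfolding A_def B_def C_def by (auto intro!: sym_pos_def_add sym_pos_def_matrix_inv S T)
  have AS: "A ** S = mat 1" "S ** A = mat 1" and BT: "B ** T = mat 1"
    and CC: "C ** matrix_inv C = mat 1" "matrix_inv C ** C = mat 1" and STU: "(S + T) ** U = mat 1"
    unfolding A_def B_def U_def by (auto intro!: matrix_inv_works sym_pos_def_invertible S T spd)
  define d where "d = x - y"
  define p q where "p = S *v (U *v d)" and "q = - (T *v (U *v d))"
  define m where "m = x - p"
  have "p - q = d"
    by (simp add: p_def q_def matrix_vector_mul_assoc STU flip: matrix_vector_mult_add_rdistrib matrix_add_rdistrib)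
  then have q: "m = y - q"
    by (simp add: m_def d_def algebra_simps)
  \<comment> \<open>\<open>A *v p\<close> and \<open>B *v q\<close> are opposite vectors, so the
    terms linear in \<open>w = u - m\<close> cancel when the two forms are added below.\<close>
  have Ap: "A *v p = U *v d"
    using AS by (simp add: p_def matrix_vector_mul_assoc matrix_mul_assoc)
  have Bq: "B *v q = - (U *v d)"
    using BT by (simp add: q_def matrix_vector_mul_assoc matrix_mul_assoc linear_neg[OF matrix_vector_mul_linear])
  have form: "(u - x) \<bullet> (A *v (u - x)) + (u - y) \<bullet> (B *v (u - y))
      = d \<bullet> (U *v d) + (u - m) \<bullet> (C *v (u - m))" for u
  proof -
    define w where "w = u - m"
    have ux: "u - x = w - p"
      by (simp add: w_def m_def)
    have uy: "u - y = w - q"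
      by (simp add: w_def q)
    have "(w - p) \<bullet> (A *v (w - p)) = w \<bullet> (A *v w) - 2 * (w \<bullet> (A *v p)) + p \<bullet> (A *v p)"
      using sym_pos_def_symmetric[OF spd(1), of p w]
      by (simp add: matrix_vector_mult_diff_distrib inner_diff_left inner_diff_right)
    moreover have "(w - q) \<bullet> (B *v (w - q)) = w \<bullet> (B *v w) - 2 * (w \<bullet> (B *v q)) + q \<bullet> (B *v q)"
      using sym_pos_def_symmetric[OF spd(2), of q w]
      by (simp add: matrix_vector_mult_diff_distrib inner_diff_left inner_diff_right)
    moreover have "p \<bullet> (U *v d) - q \<bullet> (U *v d) = d \<bullet> (U *v d)"
      using \<open>p - q = d\<close> by (simp flip: inner_diff_left)
    ultimately show ?thesis
      unfolding ux uy Ap Bq w_def[symmetric]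
      by (simp add: C_def matrix_vector_mult_add_rdistrib inner_add_right)
  qed
  have pos: "0 < det S" "0 < det T" "0 < det (S + T)" "0 < det (matrix_inv C)"
    by (intro sym_pos_def_det_pos S T spd sym_pos_def_matrix_inv)+
  \<comment> \<open>Taking determinants in
    \<open>S (S\<^sup>-\<^sup>1 + T\<^sup>-\<^sup>1) T = S + T\<close> matches the normalizing
    constants of the two sides.\<close>
  have "S ** C ** T = S + T"
    using AS BT by (simp add: C_def matrix_add_ldistrib matrix_add_rdistrib flip: matrix_mul_assoc)
  then have "det S * det C * det T = det (S + T)"
    by (metis det_mul)
  moreover have "det C * det (matrix_inv C) = 1"
    using CC(1) by (metis det_I det_mul)
  ultimately have "det S * det T = det (S + T) * det (matrix_inv C)"
    by (metis mult.assoc mult.commute mult.right_neutral)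
  then have det: "det S powr (- 1 / 2) * det T powr (- 1 / 2)
      = det (S + T) powr (- 1 / 2) * det (matrix_inv C) powr (- 1 / 2)"
    using pos by (simp flip: powr_mult)
  have "gaussian_density x S u * gaussian_density y T u
      = gaussian_density 0 (S + T) (x - y) * gaussian_density m (matrix_inv C) u" for u
  proof -
    have exps: "exp (- ((u - x) \<bullet> (A *v (u - x))) / 2) * exp (- ((u - y) \<bullet> (B *v (u - y))) / 2)
        = exp (- (d \<bullet> (U *v d)) / 2) * exp (- ((u - m) \<bullet> (C *v (u - m))) / 2)"
      using form[of u] by (simp flip: exp_add add_divide_distrib)
    have "gaussian_density x S u * gaussian_density y T u
        = (2 * pi) powr (- real CARD('n) / 2) * (2 * pi) powr (- real CARD('n) / 2)
          * (det S powr (- 1 / 2) * det T powr (- 1 / 2))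
          * (exp (- ((u - x) \<bullet> (A *v (u - x))) / 2) * exp (- ((u - y) \<bullet> (B *v (u - y))) / 2))"
      by (simp only: gaussian_density_def A_def B_def mult_ac)
    also have "\<dots> = gaussian_density 0 (S + T) (x - y) * gaussian_density m (matrix_inv C) u"
      unfolding det exps
      by (simp only: gaussian_density_def U_def d_def diff_0_right matrix_inv_eqI[OF CC(2)] mult_ac)
    finally show ?thesis .
  qed
  then show ?thesis
    unfolding C_def A_def B_def by (rule that)
qed

text \<open>In the factorized product only a probability density depends on \<open>u\<close>, so the
  other factor is the integral.\<close>

lemma has_bochner_integral_gaussian_density_mult:
  fixes S T :: "real ^ 'n ^ 'n"
  assumes "sym_pos_def S" "sym_pos_def T"
  shows "has_bochner_integral lborel (\<lambda>u. gaussian_density x S u * gaussian_density y T u)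
    (gaussian_density 0 (S + T) (x - y))"
proof -
  obtain m where m: "\<And>u. gaussian_density x S u * gaussian_density y T u
    = gaussian_density 0 (S + T) (x - y)
      * gaussian_density m (matrix_inv (matrix_inv S + matrix_inv T)) u"
    using gaussian_density_mult[OF assms] by blast
  have "has_bochner_integral lborel (gaussian_density m (matrix_inv (matrix_inv S + matrix_inv T))) 1"
    by (intro has_bochner_integral_gaussian_density sym_pos_def_matrix_inv sym_pos_def_add assms)
  from has_bochner_integral_mult_right[OF this, of "gaussian_density 0 (S + T) (x - y)"]
  show ?thesis
    by (simp add: m)
qed

section \<open>The covariance function\<close>

lemma sym_pos_def_avg_cov:
  "(\<And>x. sym_pos_def (\<Sigma> x)) \<Longrightarrow> sym_pos_def (avg_cov \<Sigma> x y)"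
  unfolding avg_cov_def by (intro sym_pos_def_scaleR sym_pos_def_add) auto

text \<open>The summed covariance is \<open>t\<^sup>2 / 2\<close> times the average. Pulled out of
  the determinant, this scalar merges with \<open>2 * pi\<close> into \<open>pi * t\<^sup>2\<close>,
  whose power \<open>-p/2\<close> gives the factor \<open>t\<close> to the \<open>-p\<close>; in the
  exponent its inverse cancels the 1/2.\<close>

lemma gaussian_density_avg_cov:
  fixes \<Sigma> :: "real ^ 'p \<Rightarrow> real ^ 'p ^ 'p"
  assumes \<Sigma>: "\<And>x. sym_pos_def (\<Sigma> x)" and t: "0 < t"
  shows "gaussian_density 0 ((t\<^sup>2 / 4) *\<^sub>R \<Sigma> x + (t\<^sup>2 / 4) *\<^sub>R \<Sigma> y) h
    = pi powr (- real CARD('p) / 2) * det (avg_cov \<Sigma> x y) powr (- 1 / 2)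
      * (t powi (- int CARD('p)) * exp (- Q_form \<Sigma> x y h / t\<^sup>2))"
proof -
  let ?S = "avg_cov \<Sigma> x y" and ?n = "real CARD('p)"
  have spd: "sym_pos_def ?S"
    using \<Sigma> by (rule sym_pos_def_avg_cov)
  have S: "(t\<^sup>2 / 4) *\<^sub>R \<Sigma> x + (t\<^sup>2 / 4) *\<^sub>R \<Sigma> y = (t\<^sup>2 / 2) *\<^sub>R ?S"
    by (simp add: avg_cov_def scaleR_add_right)
  have "(h \<bullet> (matrix_inv ((t\<^sup>2 / 2) *\<^sub>R ?S) *v h)) / 2 = Q_form \<Sigma> x y h / t\<^sup>2"
    using t by (simp add: matrix_inv_scaleR sym_pos_def_invertible spd Q_form_def
        scaleR_matrix_vector_assoc[symmetric])
  then have exp: "exp (- (h \<bullet> (matrix_inv ((t\<^sup>2 / 2) *\<^sub>R ?S) *v h)) / 2) = exp (- Q_form \<Sigma> x y h / t\<^sup>2)"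
    by simp
  have "(2 * pi) powr (- ?n / 2) * det ((t\<^sup>2 / 2) *\<^sub>R ?S) powr (- 1 / 2)
      = (2 * pi) powr (- ?n / 2) * ((t\<^sup>2 / 2) powr ?n * det ?S) powr (- 1 / 2)"
    using t by (simp add: det_scaleR powr_realpow)
  also have "\<dots> = ((2 * pi) * (t\<^sup>2 / 2)) powr (- ?n / 2) * det ?S powr (- 1 / 2)"
    using t sym_pos_def_det_pos[OF spd] by (simp only: powr_mult powr_powr) simp
  also have "(2 * pi) * (t\<^sup>2 / 2) = pi * t powr 2"
    using t by simp
  also have "(pi * t powr 2) powr (- ?n / 2) = pi powr (- ?n / 2) * t powr (- ?n)"
    using t by (simp add: powr_mult powr_powr del: powr_numeral)
  also have "t powr (- ?n) = t powi (- int CARD('p))"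
    using t by (simp add: powr_minus powr_realpow power_int_minus)
  finally show ?thesis
    unfolding S gaussian_density_def diff_0_right exp by (simp add: mult_ac)
qed

lemma Q_form_nonneg: "(\<And>x. sym_pos_def (\<Sigma> x)) \<Longrightarrow> 0 \<le> Q_form \<Sigma> x y h"
  unfolding Q_form_def by (intro sym_pos_def_nonneg sym_pos_def_matrix_inv sym_pos_def_avg_cov)

lemma has_bochner_integral_f_ns:
  fixes \<Sigma> :: "real ^ 'p \<Rightarrow> real ^ 'p ^ 'p"
  assumes \<Sigma>: "\<And>x. sym_pos_def (\<Sigma> x)" and t: "0 < t"
  shows "has_bochner_integral lborel (\<lambda>u. f_ns \<Sigma> g x u t * f_ns \<Sigma> g y u t)
    (pi powr (- real CARD('p) / 2) * det (avg_cov \<Sigma> x y) powr (- 1 / 2)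
      * (g x t * g y t * t powi (- int CARD('p)) * exp (- Q_form \<Sigma> x y (x - y) / t\<^sup>2)))"
proof -
  have "sym_pos_def ((t\<^sup>2 / 4) *\<^sub>R \<Sigma> z)" for z
    using t by (intro sym_pos_def_scaleR \<Sigma>) simp
  then have "has_bochner_integral lborel (\<lambda>u. kern \<Sigma> x u t * kern \<Sigma> y u t)
      (gaussian_density 0 ((t\<^sup>2 / 4) *\<^sub>R \<Sigma> x + (t\<^sup>2 / 4) *\<^sub>R \<Sigma> y) (x - y))"
    unfolding kern_def by (intro has_bochner_integral_gaussian_density_mult)
  from has_bochner_integral_mult_right[OF this, of "g x t * g y t"]
  show ?thesis
    by (simp add: gaussian_density_avg_cov[of \<Sigma>, OF \<Sigma> t] f_ns_def mult_ac)
qed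

text \<open>The integrability clauses exclude that the identity holds merely through the default
  value 0 of the integrals. Assumption \<open>f\<close> uses nonnegative integrals, for which
  finiteness is a genuine condition.\<close>

theorem proposition3p1:
  fixes M :: "real measure"
    and \<Sigma> :: "real ^ 'p \<Rightarrow> real ^ 'p ^ 'p"
    and g :: "real ^ 'p \<Rightarrow> real \<Rightarrow> real"
  assumes M: "sets M = sets (restrict_space borel {0<..})"
    and \<Sigma>: "\<And>x. sym_pos_def (\<Sigma> x)"
    and g: "\<And>x. g x \<in> L2 M"
    and f: "\<And>x. (\<integral>\<^sup>+ t. (\<integral>\<^sup>+ u. ennreal ((f_ns \<Sigma> g x u t)\<^sup>2) \<partial>lborel) \<partial>M) < \<infinity>"
  shows "\<forall>x y.
    (\<forall>t>0. integrable lborel (\<lambda>u. f_ns \<Sigma> g x u t * f_ns \<Sigma> g y u t)) \<and>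
    integrable M (\<lambda>t. LINT u|lborel. f_ns \<Sigma> g x u t * f_ns \<Sigma> g y u t) \<and>
    integrable M (\<lambda>t. g x t * g y t * t powi (- int CARD('p)) * exp (- Q_form \<Sigma> x y (x - y) / t\<^sup>2)) \<and>
    C_NS M \<Sigma> g x y =
      pi powr (- real CARD('p) / 2) * det (avg_cov \<Sigma> x y) powr (- 1 / 2) *
      (LINT t|M. g x t * g y t * t powi (- int CARD('p)) * exp (- Q_form \<Sigma> x y (x - y) / t\<^sup>2))"
proof (intro allI)
  fix x y
  let ?c = "\<lambda>x y. pi powr (- real CARD('p) / 2) * det (avg_cov \<Sigma> x y) powr (- 1 / 2)"
  let ?h = "\<lambda>x y t. g x t * g y t * t powi (- int CARD('p)) * exp (- Q_form \<Sigma> x y (x - y) / t\<^sup>2)"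
  \<comment> \<open>All points of \<open>M\<close> are positive, so the closed form of the inner
    integral holds everywhere on \<open>M\<close>.\<close>
  have space: "space M = {0<..}"
    using sets_eq_imp_space_eq[OF M] by (simp add: space_restrict_space)
  note inner = has_bochner_integral_f_ns[of \<Sigma>, OF \<Sigma>, where g = g]
  have c_pos: "0 < ?c x y" for x y
    using sym_pos_def_det_pos[OF sym_pos_def_avg_cov[of \<Sigma> x y, OF \<Sigma>]] by (intro mult_pos_pos) auto
  have [measurable]: "g x \<in> borel_measurable M" for x
    using g[of x] by (simp add: L2_def)
  have "(\<lambda>t. t) \<in> borel_measurable (restrict_space borel {0<..})"
    by (rule measurable_restrict_space1) simp
  then have [measurable]: "(\<lambda>t. t) \<in> borel_measurable M"
    using measurable_cong_sets[OF M refl] by blast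
  have [measurable]: "(\<lambda>t. t powi (- int CARD('p))) \<in> borel_measurable M"
    unfolding power_int_minus power_int_of_nat by measurable
  have diag: "integrable M (\<lambda>t. (g x t)\<^sup>2 * t powi (- int CARD('p)))" for x
  proof -
    \<comment> \<open>At \<open>x - x = 0\<close> the quadratic form vanishes and the exponential is
      1.\<close>
    have h: "?h x x t = (g x t)\<^sup>2 * t powi (- int CARD('p))" for t
      by (simp add: Q_form_def power2_eq_square)
    have "(\<integral>\<^sup>+u. ennreal ((f_ns \<Sigma> g x u t)\<^sup>2) \<partial>lborel) = ennreal (?c x x * ((g x t)\<^sup>2 * t powi (- int CARD('p))))"
      if "t \<in> space M" for t
      using inner[of t x x] that unfolding space h
      by (subst nn_integral_eq_integral) (auto simp: has_bochner_integral_iff power2_eq_square)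
    then have "(\<integral>\<^sup>+t. ennreal (?c x x * ((g x t)\<^sup>2 * t powi (- int CARD('p)))) \<partial>M) < \<infinity>"
      using f[of x] by (simp cong: nn_integral_cong)
    then have "integrable M (\<lambda>t. ?c x x * ((g x t)\<^sup>2 * t powi (- int CARD('p))))"
      using c_pos[of x x] by (intro integrableI_nonneg) (auto simp: space)
    then show ?thesis
      using c_pos[of x x] by (subst (asm) integrable_mult_left_iff) auto
  qed
  have int: "integrable M (?h x y)"
  proof (rule Bochner_Integration.integrable_bound)
    show "integrable M (\<lambda>t. (g x t)\<^sup>2 * t powi (- int CARD('p)) + (g y t)\<^sup>2 * t powi (- int CARD('p)))"
      by (intro Bochner_Integration.integrable_add diag)
    show "AE t in M. norm (?h x y t) \<le> norm ((g x t)\<^sup>2 * t powi (- int CARD('p)) + (g y t)\<^sup>2 * t powi (- int CARD('p)))"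
    proof (rule AE_I2)
      fix t assume "t \<in> space M"
      then have t: "0 \<le> t powi (- int CARD('p))"
        by (simp add: space)
      \<comment> \<open>Domination off the diagonal: the exponential is at most 1 because the
        quadratic form is nonnegative, and the product of the \<open>g\<close> values is bounded by
        the sum of their squares.\<close>
      have "exp (- Q_form \<Sigma> x y (x - y) / t\<^sup>2) \<le> 1"
        using Q_form_nonneg[of \<Sigma>, OF \<Sigma>] by simp
      moreover have "\<bar>g x t * g y t\<bar> \<le> (g x t)\<^sup>2 + (g y t)\<^sup>2"
        using sum_squares_bound[of "\<bar>g x t\<bar>" "\<bar>g y t\<bar>"] abs_ge_zero[of "g x t * g y t"]
        unfolding abs_mult power2_abs by linarith
      ultimately have "\<bar>g x t * g y t\<bar> * exp (- Q_form \<Sigma> x y (x - y) / t\<^sup>2) \<le> ((g x t)\<^sup>2 + (g y t)\<^sup>2) * 1"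
        by (intro mult_mono) auto
      from mult_right_mono[OF this t]
      show "norm (?h x y t) \<le> norm ((g x t)\<^sup>2 * t powi (- int CARD('p)) + (g y t)\<^sup>2 * t powi (- int CARD('p)))"
        using t by (simp add: abs_mult distrib_left mult_ac)
    qed
  qed measurable
  have eq: "(LINT u|lborel. f_ns \<Sigma> g x u t * f_ns \<Sigma> g y u t) = ?c x y * ?h x y t"
    if "t \<in> space M" for t
    using inner[of t x y] that by (auto simp: space has_bochner_integral_iff)
  show "(\<forall>t>0. integrable lborel (\<lambda>u. f_ns \<Sigma> g x u t * f_ns \<Sigma> g y u t)) \<and>
    integrable M (\<lambda>t. LINT u|lborel. f_ns \<Sigma> g x u t * f_ns \<Sigma> g y u t) \<and>
    integrable M (?h x y) \<and> C_NS M \<Sigma> g x y = ?c x y * (LINT t|M. ?h x y t)"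
  proof (intro conjI allI impI)
    show "integrable lborel (\<lambda>u. f_ns \<Sigma> g x u t * f_ns \<Sigma> g y u t)" if "0 < t" for t
      using inner[OF that] by (rule integrable.intros)
    \<comment> \<open>On \<open>M\<close> the inner integral is a constant multiple of
      \<open>?h x y\<close>, so its integrability is inherited.\<close>
    show "integrable M (\<lambda>t. LINT u|lborel. f_ns \<Sigma> g x u t * f_ns \<Sigma> g y u t)"
      using integrable_mult_right[OF int, of "?c x y"]
      by (simp only: eq cong: Bochner_Integration.integrable_cong)
    have "C_NS M \<Sigma> g x y = (LINT t|M. ?c x y * ?h x y t)"
      unfolding C_NS_def by (intro Bochner_Integration.integral_cong refl eq)
    then show "C_NS M \<Sigma> g x y = ?c x y * (LINT t|M. ?h x y t)"
      by (simp only: integral_mult_right_zero)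
  qed (rule int)
qed

end
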